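(* Let $n\geq 2$ be an integer and let $k > \max(3,(n-1)^2+1)$ be an integer. Then $$a^o_n(k) = 2a^o_n(k-1)-a^o_n(k-2)+n(n-1)\quad\text{if } k \text{ is odd},$$ and $$a^o_n(k) = 2a^o_n(k-1)-a^o_n(k-2)\quad\text{if } k \text{ is even}.$$
   Context: For integers $n\geq 1$ and $k\geq 0$, the $n$ by $k$ grid is the set of points $\{1,\dots,n\}\times\{1,\dots,k\}\subset\mathbb{R}^2$ (empty if $k=0$). $a^o_n(k)$ denotes the number of obtuse isosceles triangles of nonzero area formed by 3 distinct points of the $n$ by $k$ grid, i.e. the number of 3-element non-collinear subsets of the grid that are the vertices of a triangle with at least two sides of equal Euclidean length and with one angle strictly greater than $90^\circ$. *)

theory Defs
  imports "HOL-Analysis.Analysis"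
begin

text \<open>The type \<open>real \<times> real\<close> carries the Euclidean inner product, norm and distance of the plane.\<close>

definition grid :: "nat \<Rightarrow> nat \<Rightarrow> (real \<times> real) set" where
  "grid n k = {(real i, real j) | i j. i \<in> {1..n} \<and> j \<in> {1..k}}"

text \<open>The unoriented angle at the vertex \<open>b\<close>, in \<open>{0..pi}\<close>; meaningful for
  \<open>a \<noteq> b\<close> and \<open>c \<noteq> b\<close> only.\<close>

definition angle_at :: "'a::real_inner \<Rightarrow> 'a \<Rightarrow> 'a \<Rightarrow> real" where
  "angle_at b a c = arccos (((a - b) \<bullet> (c - b)) / (norm (a - b) * norm (c - b)))"

text \<open>A triangle is identified with its set of vertices.\<close>

definition is_triangle :: "'a::real_inner set \<Rightarrow> bool" where
  "is_triangle T \<longleftrightarrow> card T = 3 \<and> \<not> collinear T"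

definition isosceles :: "'a::real_inner set \<Rightarrow> bool" where
  "isosceles T \<longleftrightarrow> (\<exists>a b c. T = {a, b, c} \<and> dist a b = dist a c)"

definition obtuse :: "'a::real_inner set \<Rightarrow> bool" where
  "obtuse T \<longleftrightarrow> (\<exists>a b c. T = {a, b, c} \<and> angle_at b a c > pi / 2)"

text \<open>In both predicates above, \<open>a\<close>, \<open>b\<close>, \<open>c\<close> are automatically distinct when
  \<open>card T = 3\<close>.\<close>

definition num_obtuse_isosceles :: "nat \<Rightarrow> nat \<Rightarrow> nat" where
  "num_obtuse_isosceles n k =
     card {T. T \<subseteq> grid n k \<and> is_triangle T \<and> isosceles T \<and> obtuse T}"

end

theory Submission
  imports Defs
begin

text \<open>
  Write \<open>f k\<close> for the number of obtuse isosceles triangles in the \<open>n\<close> by \<open>k\<close> grid. Among the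
  triangles of the grid with \<open>k\<close> rows, those that avoid the top row are the triangles of the grid
  with \<open>k - 1\<close> rows; those that avoid the bottom row are vertical translates of these; and those
  that avoid both are translates of the triangles in \<open>k - 2\<close> rows. By inclusion and exclusion,
  \<open>f k - 2 * f (k - 1) + f (k - 2)\<close> is the number of triangles that meet both the bottom row and
  the top row (\<open>card_grid_sets_second_difference\<close>). It remains to see that a tall grid has
  \<open>n * (n - 1)\<close> such triangles if \<open>k\<close> is odd and none if \<open>k\<close> is even.

  The obtuse angle of an isosceles triangle lies between the two equal sides, at the apex. Put
  \<open>N = n - 1\<close> and \<open>K = k - 1\<close>, so that \<open>K > N\<^sup>2\<close>, and let \<open>(x, y)\<close>, \<open>(x', y')\<close> be the vectors from
  the apex to the other two vertices, with \<open>\<bar>x\<bar>, \<bar>x'\<bar> \<le> N\<close>.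

  \<^item> If the apex lies in an extreme row, then \<open>y\<close> and \<open>y'\<close> have no opposite signs and one of them,
    say \<open>y\<close>, has absolute value \<open>K\<close>. Obtuseness gives \<open>K * \<bar>y'\<bar> < - x * x' \<le> N\<^sup>2 < K\<close>, so
    \<open>y' = 0\<close>; but then the second side has length at most \<open>N\<close>, whereas the first has length at
    least \<open>K\<close> (\<open>no_apex_in_extreme_row\<close>).
  \<^item> Otherwise the other two vertices lie in the two extreme rows. Equality of the sides becomes
    \<open>K * (2 * p - K) = x'\<^sup>2 - x\<^sup>2\<close>, where \<open>p\<close> is the distance of the apex from one of the extreme
    rows, and the right-hand side is smaller than \<open>K\<close> in absolute value. Hence \<open>2 * p = K\<close> and
    \<open>x' = x\<close> or \<open>x' = - x\<close> (\<open>apex_in_middle_row\<close>). In the latter case the apex would be the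
    midpoint of the base, so the base is vertical.

  Therefore \<open>k\<close> is odd, and the triangle is determined by the column of its base and the different
  column of its apex. Conversely, all \<open>n * (n - 1)\<close> choices give an obtuse angle, since half the
  height \<open>K\<close> exceeds \<open>N\<close> (\<open>vertical_base_apex\<close>).
\<close>

section \<open>The apex of an obtuse isosceles triangle\<close>

lemma angle_at_obtuse_iff:
  fixes a b c :: "'a::real_inner"
  assumes "a \<noteq> b" "c \<noteq> b"
  shows "angle_at b a c > pi / 2 \<longleftrightarrow> (a - b) \<bullet> (c - b) < 0"
proof -
  let ?d = "norm (a - b) * norm (c - b)"
  let ?t = "((a - b) \<bullet> (c - b)) / ?d"
  have d: "?d > 0"
    using assms by simp
  have "\<bar>?t\<bar> \<le> 1"
    using Cauchy_Schwarz_ineq2[of "a - b" "c - b"] d by (simp add: abs_mult)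
  then have "arccos 0 < arccos ?t \<longleftrightarrow> ?t < 0"
    by (intro arccos_less_mono) auto
  also have "\<dots> \<longleftrightarrow> (a - b) \<bullet> (c - b) < 0"
    using d by (simp only: divide_less_0_iff) auto
  finally show ?thesis
    by (simp add: angle_at_def)
qed

text \<open>The law of cosines at \<open>b\<close>: since the sides \<open>ab\<close> and \<open>ac\<close> are equal, twice the inner product
  is the squared length of the base \<open>bc\<close>.\<close>

lemma base_angle_not_obtuse:
  fixes a b c :: "'a::real_inner"
  assumes "dist a b = dist a c"
  shows "(a - b) \<bullet> (c - b) \<ge> 0"
proof -
  have "(a - b) \<bullet> (a - b) = (a - c) \<bullet> (a - c)"
    using assms by (simp add: dist_norm norm_eq_sqrt_inner)
  moreover have "(c - b) \<bullet> (c - b) \<ge> 0"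
    by simp
  ultimately show ?thesis
    by (simp add: inner_diff_left inner_diff_right inner_commute)
qed

definition apex :: "'a::real_inner \<Rightarrow> 'a \<Rightarrow> 'a \<Rightarrow> bool" where
  "apex a b c \<longleftrightarrow> dist a b = dist a c \<and> (b - a) \<bullet> (c - a) < 0 \<and> \<not> collinear {a, b, c}"

definition obtuse_isosceles_triangle :: "'a::real_inner set \<Rightarrow> bool" where
  "obtuse_isosceles_triangle T \<longleftrightarrow> is_triangle T \<and> isosceles T \<and> obtuse T"

lemma not_collinear_distinct:
  assumes "\<not> collinear {a, b, c}"
  shows "a \<noteq> b" "a \<noteq> c" "b \<noteq> c"
  using assms by (auto simp: insert_commute)

text \<open>The predicates \<open>isosceles\<close> and \<open>obtuse\<close> choose their distinguished vertices independently.
  The two vertices coincide, because the angles at the base are not obtuse.\<close>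

lemma obtuse_isosceles_triangle_iff:
  fixes T :: "'a::real_inner set"
  shows "obtuse_isosceles_triangle T \<longleftrightarrow> (\<exists>a b c. T = {a, b, c} \<and> apex a b c)"
proof
  assume L: "obtuse_isosceles_triangle T"
  then obtain a b c where T: "T = {a, b, c}" and d: "dist a b = dist a c"
    by (auto simp: obtuse_isosceles_triangle_def isosceles_def)
  from L have nc: "\<not> collinear T"
    by (simp add: obtuse_isosceles_triangle_def is_triangle_def)
  note ne = not_collinear_distinct[OF nc[unfolded T]]
  from L obtain v p q where T': "T = {p, v, q}" and ang: "angle_at v p q > pi / 2"
    by (auto simp: obtuse_isosceles_triangle_def obtuse_def)
  have "p \<noteq> v" "p \<noteq> q" "v \<noteq> q"
    using nc T' not_collinear_distinct by blast+
  then have neg: "(p - v) \<bullet> (q - v) < 0"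
    using ang angle_at_obtuse_iff[of p v q] by simp
  have pq: "{p, q} = T - {v}"
    using T' \<open>p \<noteq> v\<close> \<open>v \<noteq> q\<close> by auto
  have "v = a"
  proof (rule ccontr)
    assume "v \<noteq> a"
    then have "v = b \<or> v = c"
      using T T' by blast
    then have "v = b \<and> {p, q} = {a, c} \<or> v = c \<and> {p, q} = {a, b}"
      unfolding pq T using ne by blast
    then have "(a - b) \<bullet> (c - b) < 0 \<or> (a - c) \<bullet> (b - c) < 0"
      using neg inner_commute[of "p - v" "q - v"] unfolding doubleton_eq_iff by metis
    with base_angle_not_obtuse[OF d] base_angle_not_obtuse[OF d[symmetric]] show False
      by linarith
  qed
  then have "{p, q} = {b, c}"
    unfolding pq T using ne by blast
  then have "(b - a) \<bullet> (c - a) < 0"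
    using neg \<open>v = a\<close> by (auto simp: doubleton_eq_iff inner_commute)
  then show "\<exists>a b c. T = {a, b, c} \<and> apex a b c"
    using T d nc by (auto simp: apex_def)
next
  assume "\<exists>a b c. T = {a, b, c} \<and> apex a b c"
  then obtain a b c where T: "T = {a, b, c}" and ap: "apex a b c"
    by blast
  then have ne: "a \<noteq> b" "a \<noteq> c" "b \<noteq> c"
    using not_collinear_distinct unfolding apex_def by blast+
  then have "angle_at a b c > pi / 2"
    using ap angle_at_obtuse_iff[of b a c] by (simp add: apex_def)
  moreover have "T = {b, a, c}"
    using T by auto
  ultimately have "obtuse T"
    unfolding obtuse_def by blast
  with T ap ne show "obtuse_isosceles_triangle T"
    by (auto simp: obtuse_isosceles_triangle_def is_triangle_def isosceles_def apex_def)
qed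

lemma obtuse_isosceles_triangle_translation:
  fixes T :: "'a::real_inner set"
  assumes "obtuse_isosceles_triangle T"
  shows "obtuse_isosceles_triangle ((+) v ` T)"
proof -
  obtain a b c where T: "T = {a, b, c}" and ap: "apex a b c"
    using assms unfolding obtuse_isosceles_triangle_iff by blast
  have "collinear {v + a, v + b, v + c} \<longleftrightarrow> collinear {a, b, c}"
    by (simp add: collinear_def)
  then have "apex (v + a) (v + b) (v + c)"
    using ap by (simp add: apex_def)
  then show ?thesis
    unfolding obtuse_isosceles_triangle_iff T by auto
qed

section \<open>Second difference of the number of sets in a growing grid\<close>

definition grid_sets :: "((real \<times> real) set \<Rightarrow> bool) \<Rightarrow> nat \<Rightarrow> nat \<Rightarrow> (real \<times> real) set set" where
  "grid_sets Q n m = {T. T \<subseteq> grid n m \<and> Q T}"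

lemma grid_eq_image: "grid n m = (\<lambda>(i, j). (real i, real j)) ` ({1..n} \<times> {1..m})"
  by (auto simp: grid_def)

lemma mem_grid_iff: "(real i, real j) \<in> grid n m \<longleftrightarrow> i \<in> {1..n} \<and> j \<in> {1..m}"
  by (auto simp: grid_def)

lemma finite_grid_sets: "finite (grid_sets Q n m)"
  unfolding grid_sets_def grid_eq_image
  by (rule finite_subset[of _ "Pow ((\<lambda>(i, j). (real i, real j)) ` ({1..n} \<times> {1..m}))"]) auto

lemma grid_drop_top_row: "grid n m = {p \<in> grid n (Suc m). snd p \<noteq> real (Suc m)}"
  by (auto simp: grid_def)

lemma grid_drop_bottom_row:
  "(+) (0, 1) ` grid n m = {p \<in> grid n (Suc m). snd p \<noteq> 1}"
proof (intro set_eqI iffI)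
  fix p assume "p \<in> (+) (0, 1) ` grid n m"
  then obtain i j where "p = (real i, real (Suc j))" "i \<in> {1..n}" "j \<in> {1..m}"
    by (auto simp: grid_def)
  then show "p \<in> {p \<in> grid n (Suc m). snd p \<noteq> 1}"
    by (auto simp: mem_grid_iff simp del: of_nat_Suc)
next
  fix p assume "p \<in> {p \<in> grid n (Suc m). snd p \<noteq> 1}"
  then obtain i j where p: "p = (real i, real j)" "i \<in> {1..n}" "j \<in> {1..Suc m}" "j \<noteq> 1"
    by (auto simp: grid_def)
  then have "(real i, real (j - 1)) \<in> grid n m"
    by (auto simp only: mem_grid_iff atLeastAtMost_iff)
  moreover have "p = (0, 1) + (real i, real (j - 1))"
    using p by (simp add: of_nat_diff)
  ultimately show "p \<in> (+) (0, 1) ` grid n m"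
    by blast
qed

lemma grid_sets_drop_top_row:
  "grid_sets Q n m = {T \<in> grid_sets Q n (Suc m). \<forall>p\<in>T. snd p \<noteq> real (Suc m)}"
  unfolding grid_sets_def by (subst grid_drop_top_row) blast

lemma card_grid_sets_avoiding_bottom_row:
  assumes inv: "\<And>v T. Q T \<Longrightarrow> Q ((+) v ` T)"
  shows "card {T \<in> grid_sets Q n (Suc m). \<forall>p\<in>T. snd p \<noteq> 1} = card (grid_sets Q n m)"
proof -
  have "{T \<in> grid_sets Q n (Suc m). \<forall>p\<in>T. snd p \<noteq> 1} = (`) ((+) (0, 1)) ` grid_sets Q n m"
    (is "?L = ?R")
  proof (intro equalityI subsetI)
    fix T assume "T \<in> ?L"
    then have T: "T \<subseteq> (+) (0, 1) ` grid n m" "Q T"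
      unfolding grid_drop_bottom_row grid_sets_def by auto
    then obtain U where U: "U \<subseteq> grid n m" "T = (+) (0, 1) ` U"
      by (auto simp: subset_image_iff)
    have "U = (+) (- (0, 1)) ` T"
      unfolding U(2) image_image by (simp add: add.assoc[symmetric] flip: zero_prod_def)
    with inv T(2) have "Q U"
      by simp
    with U show "T \<in> ?R"
      by (auto simp: grid_sets_def)
  next
    fix T assume "T \<in> ?R"
    then obtain U where U: "U \<subseteq> grid n m" "Q U" "T = (+) (0, 1) ` U"
      by (auto simp: grid_sets_def)
    then have "T \<subseteq> {p \<in> grid n (Suc m). snd p \<noteq> 1}"
      unfolding grid_drop_bottom_row[symmetric] by blast
    with U inv show "T \<in> ?L"
      by (auto simp: grid_sets_def)
  qed
  moreover have "inj_on ((`) ((+) (0 :: real, 1 :: real))) A" for A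
    by (rule inj_onI) (simp add: inj_image_eq_iff)
  ultimately show ?thesis
    by (simp add: card_image)
qed

definition spanning :: "nat \<Rightarrow> (real \<times> real) set \<Rightarrow> bool" where
  "spanning k T \<longleftrightarrow> (\<exists>p\<in>T. snd p = 1) \<and> (\<exists>p\<in>T. snd p = real k)"

text \<open>Inclusion and exclusion for the sets that avoid the top row and the sets that avoid the
  bottom row; the sets that avoid neither are the spanning ones.\<close>

lemma card_grid_sets_second_difference:
  assumes inv: "\<And>v T. Q T \<Longrightarrow> Q ((+) v ` T)"
  shows "card (grid_sets Q n (Suc (Suc m))) + card (grid_sets Q n m) =
    2 * card (grid_sets Q n (Suc m)) + card {T \<in> grid_sets Q n (Suc (Suc m)). spanning (Suc (Suc m)) T}"
proof -
  let ?k = "Suc (Suc m)"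
  let ?F = "grid_sets Q n"
  define A where "A = {T \<in> ?F ?k. \<forall>p\<in>T. snd p \<noteq> real ?k}"
  define B where "B = {T \<in> ?F ?k. \<forall>p\<in>T. snd p \<noteq> 1}"
  define G where "G = {T \<in> ?F ?k. spanning ?k T}"
  have fin: "finite A" "finite B" "finite G"
    using finite_grid_sets[of Q n ?k] by (auto simp: A_def B_def G_def)
  have A: "A = ?F (Suc m)"
    unfolding A_def by (rule grid_sets_drop_top_row[symmetric])
  have "A \<inter> B = {T \<in> ?F (Suc m). \<forall>p\<in>T. snd p \<noteq> 1}"
    unfolding A[symmetric] by (auto simp: A_def B_def)
  then have AB: "card (A \<inter> B) = card (?F m)"
    using card_grid_sets_avoiding_bottom_row[of Q n m] inv by simp
  have B: "card B = card (?F (Suc m))"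
    unfolding B_def using inv by (rule card_grid_sets_avoiding_bottom_row)
  have "?F ?k = (A \<union> B) \<union> G" "(A \<union> B) \<inter> G = {}"
    by (auto simp: A_def B_def G_def spanning_def)
  then have "card (?F ?k) = card (A \<union> B) + card G"
    using fin by (simp add: card_Un_disjoint)
  then show ?thesis
    using card_Un_Int[OF fin(1,2)] A AB B by (simp add: G_def)
qed

section \<open>Arithmetic of tall triangles\<close>

text \<open>Here \<open>(x, K)\<close> and \<open>(y, q)\<close> are two sides of equal length that leave the apex towards the same
  vertical direction, the first one of full height. An obtuse angle would need
  \<open>K * q < - x * y \<le> N\<^sup>2 < K\<close>, so the second side would be horizontal and far too short.\<close>

lemma no_apex_in_extreme_row:
  fixes x y q K N :: int
  assumes "\<bar>x\<bar> \<le> N" "\<bar>y\<bar> \<le> N" "N\<^sup>2 < K" "q \<ge> 0"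
    and eq: "x\<^sup>2 + K\<^sup>2 = y\<^sup>2 + q\<^sup>2"
  shows "x * y + K * q \<ge> 0"
proof (rule ccontr)
  assume neg: "\<not> x * y + K * q \<ge> 0"
  have "\<bar>x * y\<bar> \<le> N\<^sup>2"
    using assms(1,2) by (simp add: abs_mult power2_eq_square mult_mono)
  then have "K * q < K * 1"
    using neg \<open>N\<^sup>2 < K\<close> by linarith
  moreover have K: "K > 0"
    using \<open>N\<^sup>2 < K\<close> zero_le_power2[of N] by linarith
  ultimately have "q = 0"
    using \<open>q \<ge> 0\<close> by (simp add: mult_less_cancel_left)
  then have "K\<^sup>2 \<le> y\<^sup>2"
    using eq zero_le_power2[of x] unfolding \<open>q = 0\<close> zero_power2 by linarith
  also have "\<dots> \<le> N\<^sup>2"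
    using assms(2) by (simp add: abs_le_square_iff[symmetric])
  finally have "K * K < K * 1"
    using \<open>N\<^sup>2 < K\<close> by (simp add: power2_eq_square)
  then show False
    using K by (simp add: mult_less_cancel_left)
qed

text \<open>Here \<open>(x, - p)\<close> and \<open>(y, K - p)\<close> are two sides of equal length that go from an apex at height
  \<open>p\<close> to the rows at heights \<open>0\<close> and \<open>K\<close>. Equality of the lengths
  makes \<open>y\<^sup>2 - x\<^sup>2\<close>, of absolute value at most \<open>N\<^sup>2 < K\<close>, a multiple of \<open>K\<close>, so it vanishes.\<close>

lemma apex_in_middle_row:
  fixes x y p K N :: int
  assumes "\<bar>x\<bar> \<le> N" "\<bar>y\<bar> \<le> N" "N\<^sup>2 < K"
    and eq: "x\<^sup>2 + p\<^sup>2 = y\<^sup>2 + (K - p)\<^sup>2"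
  shows "2 * p = K" and "x = y \<or> x = - y"
proof -
  have K: "K > 0"
    using \<open>N\<^sup>2 < K\<close> zero_le_power2[of N] by linarith
  have "x\<^sup>2 \<le> N\<^sup>2" "y\<^sup>2 \<le> N\<^sup>2"
    using assms(1,2) by (simp_all add: abs_le_square_iff[symmetric])
  moreover have "K * (2 * p - K) = y\<^sup>2 - x\<^sup>2"
    using eq by (simp add: power2_eq_square algebra_simps)
  ultimately have "\<bar>K * (2 * p - K)\<bar> < K * 1"
    using \<open>N\<^sup>2 < K\<close> zero_le_power2[of x] zero_le_power2[of y] by linarith
  then have "\<bar>2 * p - K\<bar> < 1"
    using K by (simp add: abs_mult)
  then show "2 * p = K"
    by simp
  then have "K - p = p"
    by simp
  with eq show "x = y \<or> x = - y"
    by (simp add: power2_eq_iff)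
qed

section \<open>Triangles that meet the bottom and the top row\<close>

lemma collinear_plane_iff:
  fixes x0 y0 x1 y1 x2 y2 :: real
  shows "collinear {(x0, y0), (x1, y1), (x2, y2)} \<longleftrightarrow>
    (x1 - x0) * (y2 - y0) = (x2 - x0) * (y1 - y0)" (is "?L \<longleftrightarrow> ?R")
proof
  assume ?L
  then have "(x0, y0) = (x2, y2) \<or> (\<exists>u. (x1, y1) = u *\<^sub>R (x0, y0) + (1 - u) *\<^sub>R (x2, y2))"
    by (simp only: collinear_3_expand)
  then show ?R
  proof
    assume "\<exists>u. (x1, y1) = u *\<^sub>R (x0, y0) + (1 - u) *\<^sub>R (x2, y2)"
    then obtain u where "x1 = u * x0 + (1 - u) * x2" "y1 = u * y0 + (1 - u) * y2"
      by auto
    then have "x1 - x0 = (1 - u) * (x2 - x0)" "y1 - y0 = (1 - u) * (y2 - y0)"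
      by (simp_all add: algebra_simps)
    then show ?R
      by simp
  qed simp
next
  assume R: ?R
  \<comment> \<open>The coordinate of the middle point along the line through the other two, read off the
    abscissae unless that line is vertical.\<close>
  define u where "u = (if x0 = x2 then (y1 - y2) / (y0 - y2) else (x1 - x2) / (x0 - x2))"
  have "x1 = u * x0 + (1 - u) * x2 \<and> y1 = u * y0 + (1 - u) * y2" if "(x0, y0) \<noteq> (x2, y2)"
  proof (cases "x0 = x2")
    case True
    with that R have "y0 \<noteq> y2" "x1 = x2"
      by auto
    moreover have "u * (y0 - y2) = y1 - y2"
      using True \<open>y0 \<noteq> y2\<close> by (simp add: u_def)
    ultimately show ?thesis
      using True by (simp add: algebra_simps)
  next
    case False
    then have u: "u * (x0 - x2) = x1 - x2"
      by (simp add: u_def)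
    have "(x0 - x2) * (y1 - y2) = (x1 - x2) * (y0 - y2)"
      using R by (simp add: algebra_simps)
    also have "\<dots> = (x0 - x2) * (u * (y0 - y2))"
      by (simp add: u[symmetric])
    finally have "y1 - y2 = u * (y0 - y2)"
      using False by simp
    with u show ?thesis
      by (simp add: algebra_simps)
  qed
  then show ?L
    unfolding collinear_3_expand by auto
qed

text \<open>For grid points the metric condition on an apex is a statement about integers, which is what
  the two lemmas on tall triangles need.\<close>

lemma apex_grid_iff:
  fixes i0 j0 i1 j1 i2 j2 :: nat
  defines "x1 \<equiv> int i1 - int i0" and "y1 \<equiv> int j1 - int j0"
    and "x2 \<equiv> int i2 - int i0" and "y2 \<equiv> int j2 - int j0"
  shows "apex (real i0, real j0) (real i1, real j1) (real i2, real j2) \<longleftrightarrow>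
    x1\<^sup>2 + y1\<^sup>2 = x2\<^sup>2 + y2\<^sup>2 \<and> x1 * x2 + y1 * y2 < 0 \<and> x1 * y2 \<noteq> x2 * y1"
proof -
  have x: "real i1 - real i0 = of_int x1" "real j1 - real j0 = of_int y1"
    "real i2 - real i0 = of_int x2" "real j2 - real j0 = of_int y2"
    by (simp_all add: x1_def y1_def x2_def y2_def)
  have d: "dist (real i0, real j0) (real i1, real j1) = sqrt (of_int (x1\<^sup>2 + y1\<^sup>2))"
    "dist (real i0, real j0) (real i2, real j2) = sqrt (of_int (x2\<^sup>2 + y2\<^sup>2))"
    by (simp_all add: dist_Pair_Pair dist_real_def x[symmetric] power2_commute)
  have i: "((real i1, real j1) - (real i0, real j0)) \<bullet> ((real i2, real j2) - (real i0, real j0))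
      = of_int (x1 * x2 + y1 * y2)"
    by (simp add: x)
  have c: "collinear {(real i0, real j0), (real i1, real j1), (real i2, real j2)} \<longleftrightarrow>
      real_of_int (x1 * y2) = of_int (x2 * y1)"
    by (simp add: collinear_plane_iff x)
  show ?thesis
    unfolding apex_def d i c real_sqrt_eq_iff of_int_eq_iff of_int_less_0_iff by simp
qed

text \<open>The vertical components of the two equal sides have opposite signs: otherwise the apex lies in
  an extreme row and one side has full height. So the base joins the extreme rows and the apex is
  half-way between them; among the two horizontal positions left, noncollinearity excludes the
  midpoint of a slanted base.\<close>

lemma spanning_apex_base:
  assumes pts: "i0 \<in> {1..n}" "i1 \<in> {1..n}" "i2 \<in> {1..n}"
      "j0 \<in> {1..k}" "j1 \<in> {1..k}" "j2 \<in> {1..k}"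
    and k: "k > (n - 1)\<^sup>2 + 1"
    and ap: "apex (real i0, real j0) (real i1, real j1) (real i2, real j2)"
    and rows: "1 \<in> {j0, j1, j2}" "k \<in> {j0, j1, j2}"
  shows "{j1, j2} = {1, k} \<and> i1 = i2 \<and> i0 \<noteq> i1 \<and> 2 * j0 = k + 1"
proof -
  define N K where "N = int n - 1" and "K = int k - 1"
  define x1 y1 x2 y2 where "x1 = int i1 - int i0" and "y1 = int j1 - int j0"
    and "x2 = int i2 - int i0" and "y2 = int j2 - int j0"
  note defs = N_def K_def x1_def y1_def x2_def y2_def
  have "n \<ge> 1"
    using pts(1) by simp
  then have "int ((n - 1)\<^sup>2 + 1) = N\<^sup>2 + 1"
    by (simp add: N_def of_nat_diff)
  with k have NK: "N\<^sup>2 < K"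
    unfolding K_def by linarith
  then have "K > 0"
    using zero_le_power2[of N] by linarith
  then have "k \<noteq> 1"
    by (auto simp: K_def)
  have x: "\<bar>x1\<bar> \<le> N" "\<bar>x2\<bar> \<le> N"
    using pts by (auto simp: defs)
  from ap have eq: "x1\<^sup>2 + y1\<^sup>2 = x2\<^sup>2 + y2\<^sup>2" and neg: "x1 * x2 + y1 * y2 < 0"
    and nc: "x1 * y2 \<noteq> x2 * y1"
    by (simp_all add: apex_grid_iff defs)
  have "y1 * y2 < 0"
  proof (rule ccontr)
    assume same: "\<not> y1 * y2 < 0"
    have "\<bar>y1\<bar> = K \<or> \<bar>y2\<bar> = K"
    proof -
      have "j0 = 1 \<or> j0 = k"
      proof (rule ccontr)
        assume "\<not> (j0 = 1 \<or> j0 = k)"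
        with rows \<open>k \<noteq> 1\<close> have "j1 = 1 \<and> j2 = k \<or> j1 = k \<and> j2 = 1" "j0 \<noteq> 1" "j0 \<noteq> k"
          by auto
        with pts have "y1 < 0 \<and> y2 > 0 \<or> y1 > 0 \<and> y2 < 0"
          by (auto simp: defs)
        with same show False
          by (auto simp: mult_less_0_iff)
      qed
      with rows \<open>k \<noteq> 1\<close> pts show ?thesis
        by (auto simp: defs)
    qed
    moreover have prod: "y1 * y2 = \<bar>y1\<bar> * \<bar>y2\<bar>"
      using same by (simp flip: abs_mult)
    moreover have eq': "x1\<^sup>2 + \<bar>y1\<bar>\<^sup>2 = x2\<^sup>2 + \<bar>y2\<bar>\<^sup>2"
      using eq by simp
    ultimately show False
    proof (elim disjE)
      assume "\<bar>y1\<bar> = K"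
      then have "x1 * x2 + K * \<bar>y2\<bar> \<ge> 0"
        using eq' by (intro no_apex_in_extreme_row[OF x NK]) simp_all
      then show False
        using neg prod \<open>\<bar>y1\<bar> = K\<close> by simp
    next
      assume "\<bar>y2\<bar> = K"
      then have "x2 * x1 + K * \<bar>y1\<bar> \<ge> 0"
        using eq' by (intro no_apex_in_extreme_row[OF x(2,1) NK]) simp_all
      then show False
        using neg prod \<open>\<bar>y2\<bar> = K\<close> by (simp add: mult.commute)
    qed
  qed
  then have "j0 \<noteq> 1" "j0 \<noteq> k"
    using pts by (auto simp: defs mult_less_0_iff)
  then have ends: "j1 = 1 \<and> j2 = k \<or> j1 = k \<and> j2 = 1"
    using rows \<open>k \<noteq> 1\<close> by auto
  then have mid: "2 * \<bar>y1\<bar> = K" and opp: "y2 = - y1" and xx: "x1 = x2 \<or> x1 = - x2"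
  proof -
    have y: "\<bar>y2\<bar> = K - \<bar>y1\<bar>"
      using ends pts by (auto simp: defs)
    then have eq': "x1\<^sup>2 + \<bar>y1\<bar>\<^sup>2 = x2\<^sup>2 + (K - \<bar>y1\<bar>)\<^sup>2"
      using eq by (simp flip: y)
    show mid: "2 * \<bar>y1\<bar> = K" and "x1 = x2 \<or> x1 = - x2"
      using apex_in_middle_row[OF x NK eq'] by auto
    with y have "\<bar>y2\<bar> = \<bar>y1\<bar>"
      by linarith
    with \<open>y1 * y2 < 0\<close> show "y2 = - y1"
      by (auto simp: abs_eq_iff)
  qed
  with nc have "x1 = x2" "x1 \<noteq> 0"
    by auto
  moreover have "2 * int j0 = int k + 1"
    using ends opp by (auto simp: defs)
  ultimately show ?thesis
    using ends by (auto simp: defs)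
qed

text \<open>The angle is obtuse exactly if the apex is horizontally closer to the base than half the length
  \<open>k - 1\<close> of the base. For \<open>n \<ge> 3\<close> this follows from \<open>2 * (n - 1) \<le> (n - 1)\<^sup>2 < k - 1\<close>. For \<open>n = 2\<close>
  it needs \<open>k > 3\<close>: with \<open>k = 3\<close> the angle would be a right angle.\<close>

lemma vertical_base_apex:
  assumes "i \<in> {1..n}" "i0 \<in> {1..n}" "i \<noteq> i0"
    and k: "k > max 3 ((n - 1)\<^sup>2 + 1)" and mid: "2 * m = k + 1"
  shows "apex (real i0, real m) (real i, real 1) (real i, real k)"
proof -
  define x y where "x = int i - int i0" and "y = int m - 1"
  have kk: "int k - int m = y" "int 1 - int m = - y"
    using mid by (simp_all add: y_def)
  have "\<bar>x\<bar> \<le> int (n - 1)" "x \<noteq> 0"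
    using assms(1-3) by (auto simp: x_def)
  have "\<bar>x\<bar> < y"
  proof (cases "n \<le> 2")
    case True
    with k mid \<open>\<bar>x\<bar> \<le> int (n - 1)\<close> show ?thesis
      by (auto simp: y_def)
  next
    case False
    then have "2 * (n - 1) \<le> (n - 1)\<^sup>2"
      by (simp add: power2_eq_square)
    with k mid \<open>\<bar>x\<bar> \<le> int (n - 1)\<close> show ?thesis
      by (auto simp: y_def)
  qed
  then have "x * x < y * y"
    using power_strict_mono[of "\<bar>x\<bar>" y 2] by (simp add: power2_eq_square)
  moreover have "y \<noteq> 0"
    using \<open>\<bar>x\<bar> < y\<close> by auto
  ultimately show ?thesis
    using \<open>x \<noteq> 0\<close> unfolding apex_grid_iff kk x_def[symmetric] by simp
qed

lemma card_spanning_triangles: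
  assumes k: "k > max 3 ((n - 1)\<^sup>2 + 1)"
  shows "card {T \<in> grid_sets obtuse_isosceles_triangle n k. spanning k T} =
    (if odd k then n * (n - 1) else 0)"
proof -
  let ?G = "{T \<in> grid_sets obtuse_isosceles_triangle n k. spanning k T}"
  define tri where "tri m = (\<lambda>(i, i0). {(real i0, real m), (real i, real 1), (real i, real k)})"
    for m :: nat
  define I where "I = (SIGMA i:{1..n}. {1..n} - {i})"
  have sub: "\<exists>m p. 2 * m = k + 1 \<and> p \<in> I \<and> T = tri m p" if "T \<in> ?G" for T
  proof -
    from that have "obtuse_isosceles_triangle T" and "T \<subseteq> grid n k" and sp: "spanning k T"
      by (simp_all add: grid_sets_def)
    then obtain a b c where T: "T = {a, b, c}" and ap: "apex a b c"
      and g: "a \<in> grid n k" "b \<in> grid n k" "c \<in> grid n k"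
      unfolding obtuse_isosceles_triangle_iff by blast
    from g obtain i0 j0 i1 j1 i2 j2 where
      abc: "a = (real i0, real j0)" "b = (real i1, real j1)" "c = (real i2, real j2)"
      and pts: "i0 \<in> {1..n}" "i1 \<in> {1..n}" "i2 \<in> {1..n}"
        "j0 \<in> {1..k}" "j1 \<in> {1..k}" "j2 \<in> {1..k}"
      by (auto simp: grid_def)
    have rows: "1 \<in> {j0, j1, j2}" "k \<in> {j0, j1, j2}"
      using sp by (auto simp: T abc spanning_def)
    have "{j1, j2} = {1, k} \<and> i1 = i2 \<and> i0 \<noteq> i1 \<and> 2 * j0 = k + 1"
      by (rule spanning_apex_base[OF pts _ ap[unfolded abc] rows]) (use k in simp)
    then have "2 * j0 = k + 1" "(i1, i0) \<in> I" "T = tri j0 (i1, i0)"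
      using pts by (auto simp: I_def T abc tri_def doubleton_eq_iff)
    then show ?thesis
      by blast
  qed
  show ?thesis
  proof (cases "odd k")
    case True
    then obtain m where m: "2 * m = k + 1"
      by (metis dvd_def even_plus_one_iff)
    then have mk: "m \<in> {1..k}" "m \<noteq> 1" "m \<noteq> k" "k \<noteq> 1"
      using k by auto
    have "?G = tri m ` I"
    proof (intro equalityI subsetI)
      fix T assume "T \<in> ?G"
      from sub[OF this] m show "T \<in> tri m ` I"
        by (metis image_eqI mult_cancel1 zero_neq_numeral)
    next
      fix T assume "T \<in> tri m ` I"
      then obtain i i0 where "(i, i0) \<in> I" and tri: "T = tri m (i, i0)"
        by auto
      then have i: "i \<in> {1..n}" "i0 \<in> {1..n}" "i \<noteq> i0"
        by (simp_all add: I_def)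
      have T: "T = {(real i0, real m), (real i, real 1), (real i, real k)}"
        by (simp add: tri tri_def)
      have "obtuse_isosceles_triangle T"
        using vertical_base_apex[OF i k m] T obtuse_isosceles_triangle_iff by blast
      moreover have "T \<subseteq> grid n k"
        using i mk by (simp only: T insert_subset mem_grid_iff) auto
      moreover have "spanning k T"
        by (auto simp: T spanning_def)
      ultimately show "T \<in> ?G"
        by (simp add: grid_sets_def)
    qed
    moreover have "inj_on (tri m) I"
    proof (rule inj_onI)
      fix p q assume eq: "tri m p = tri m q"
      \<comment> \<open>The three rows are different, so the bottom row gives back the column of the base and the
        middle row that of the apex.\<close>
      have mem: "(real x, real m) \<in> tri m r \<longleftrightarrow> x = snd r" "(real x, real 1) \<in> tri m r \<longleftrightarrow> x = fst r" for x r
        using mk by (auto simp: tri_def split: prod.splits)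
      have "fst p = fst q"
        using mem(2)[of "fst p" p] mem(2)[of "fst p" q] unfolding eq by blast
      moreover have "snd p = snd q"
        using mem(1)[of "snd p" p] mem(1)[of "snd p" q] unfolding eq by blast
      ultimately show "p = q"
        by (rule prod_eqI)
    qed
    moreover have "card I = (\<Sum>i\<in>{1..n}. card ({1..n} - {i}))"
      unfolding I_def by (rule card_SigmaI) auto
    moreover have "\<dots> = n * (n - 1)"
      by simp
    ultimately show ?thesis
      using True by (simp add: card_image)
  next
    case False
    have "T \<notin> ?G" for T
    proof
      assume "T \<in> ?G"
      from sub[OF this] obtain m where "2 * m = k + 1"
        by blast
      with False show False
        by presburger
    qed
    then have "?G = {}"
      by blast
    then show ?thesis
      using False by (simp only: card.empty if_False)
  qed
qed

theorem theorem4: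
  fixes n k :: nat
  assumes "n \<ge> 2" and "k > max 3 ((n - 1)\<^sup>2 + 1)"
  shows "(odd k \<longrightarrow>
            int (num_obtuse_isosceles n k) =
              2 * int (num_obtuse_isosceles n (k - 1)) - int (num_obtuse_isosceles n (k - 2))
                + int n * (int n - 1)) \<and>
         (even k \<longrightarrow>
            int (num_obtuse_isosceles n k) =
              2 * int (num_obtuse_isosceles n (k - 1)) - int (num_obtuse_isosceles n (k - 2)))"
proof -
  let ?F = "grid_sets obtuse_isosceles_triangle n"
  have num: "num_obtuse_isosceles n m = card (?F m)" for m
    by (simp add: num_obtuse_isosceles_def grid_sets_def obtuse_isosceles_triangle_def)
  obtain m where m: "k = Suc (Suc m)"
    using assms(2) by (intro that[of "k - 2"]) auto
  have "card (?F k) + card (?F (k - 2)) =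
      2 * card (?F (k - 1)) + card {T \<in> ?F k. spanning k T}"
    using card_grid_sets_second_difference[of obtuse_isosceles_triangle n m,
        OF obtuse_isosceles_triangle_translation]
    by (simp add: m)
  then have "card (?F k) + card (?F (k - 2)) =
      2 * card (?F (k - 1)) + (if odd k then n * (n - 1) else 0)"
    using card_spanning_triangles[OF assms(2)] by simp
  then have "int (card (?F k)) + int (card (?F (k - 2))) =
      2 * int (card (?F (k - 1))) + (if odd k then int (n * (n - 1)) else 0)"
    by (simp flip: of_nat_add of_nat_mult split: if_splits)
  moreover have "int (n * (n - 1)) = int n * (int n - 1)"
    using assms(1) by (simp add: of_nat_diff)
  ultimately show ?thesis
    unfolding num by auto
qed

end
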